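(* Let $G \leqslant \mathrm{Sym}(n)$ be a semiprimitive group such that $\mathrm{Alt}(n) \not\leq G$. Then $$|\mathrm{Sym}(n):G| \geqslant \left\lfloor \frac{n+1}{2}\right\rfloor!.$$
   Context: A permutation group is semiregular if all its point-stabilisers are trivial. A transitive permutation group is semiprimitive if every normal subgroup is transitive or semiregular. *)

theory Defs
  imports "HOL-Algebra.Sym_Groups" "HOL-Algebra.Group_Action"
begin

text \<open>
  A permutation group of degree \<open>n\<close> is given by its underlying set \<open>G\<close>, a subgroup of
  \<^term>\<open>sym_group n\<close>; it acts on \<open>{1..n}\<close> by evaluation. Restricting the
  permutations to \<open>{1..n}\<close> is needed because the elements of
  \<^term>\<open>carrier (BijGroup E)\<close> are undefined outside \<open>E\<close>, whereas
  permutations are the identity there.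
\<close>

abbreviation perm_group :: "nat \<Rightarrow> (nat \<Rightarrow> nat) set \<Rightarrow> (nat \<Rightarrow> nat) monoid"
  where "perm_group n G \<equiv> (sym_group n)\<lparr>carrier := G\<rparr>"

abbreviation perm_action :: "nat \<Rightarrow> (nat \<Rightarrow> nat) \<Rightarrow> nat \<Rightarrow> nat"
  where "perm_action n \<equiv> (\<lambda>g. restrict g {1..n})"

definition transitive_perm_group :: "nat \<Rightarrow> (nat \<Rightarrow> nat) set \<Rightarrow> bool"
  where "transitive_perm_group n G \<longleftrightarrow>
    subgroup G (sym_group n) \<and> transitive_action (perm_group n G) {1..n} (perm_action n)"

definition semiregular_perm_group :: "nat \<Rightarrow> (nat \<Rightarrow> nat) set \<Rightarrow> bool"
  where "semiregular_perm_group n G \<longleftrightarrow>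
    subgroup G (sym_group n) \<and>
    (\<forall>x \<in> {1..n}. stabilizer (perm_group n G) (perm_action n) x = {\<one>\<^bsub>sym_group n\<^esub>})"

definition semiprimitive_perm_group :: "nat \<Rightarrow> (nat \<Rightarrow> nat) set \<Rightarrow> bool"
  where "semiprimitive_perm_group n G \<longleftrightarrow>
    transitive_perm_group n G \<and>
    (\<forall>N. N \<lhd> perm_group n G \<longrightarrow> transitive_perm_group n N \<or> semiregular_perm_group n N)"

lemma perm_action_group_action:
  assumes "subgroup G (sym_group n)"
  shows "group_action (perm_group n G) {1..n} (perm_action n)"
proof -
  have perm: "g permutes {1..n}" if "g \<in> G" for g
    using subgroup.subset[OF assms] that sym_group_carrier by blast
  have bij: "perm_action n g \<in> Bij {1..n}" if "g \<in> G" for g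
    using permutes_imp_bij[OF perm[OF that]] unfolding Bij_def
    by (simp only: Int_iff mem_Collect_eq bij_betw_restrict_eq restrict_extensional)
  have comp: "perm_action n (g \<circ> h) = compose {1..n} (perm_action n g) (perm_action n h)"
    if "h \<in> G" for g h
  proof
    fix x
    show "perm_action n (g \<circ> h) x = compose {1..n} (perm_action n g) (perm_action n h) x"
    proof (cases "x \<in> {1..n}")
      case True
      then have "h x \<in> {1..n}"
        using permutes_in_image[OF perm[OF that]] by blast
      then show ?thesis
        using True by (simp only: compose_def restrict_apply if_True o_apply)
    next
      case False
      then show ?thesis
        by (simp only: compose_def restrict_apply if_False)
    qed
  qed
  have "perm_action n \<in> hom (perm_group n G) (BijGroup {1..n})"
    using bij comp unfolding hom_def BijGroup_def
    by (simp add: sym_group_mult del: atLeastAtMost_iff)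
  moreover have "group (perm_group n G)"
    using subgroup.subgroup_is_group[OF assms sym_group_is_group] .
  ultimately show ?thesis
    by (simp only: group_action_def group_hom_def group_hom_axioms_def group_BijGroup simp_thms)
qed

lemma transitive_perm_group_iff:
  "transitive_perm_group n G \<longleftrightarrow>
    subgroup G (sym_group n) \<and> (\<forall>x \<in> {1..n}. \<forall>y \<in> {1..n}. \<exists>g \<in> G. g x = y)"
proof (cases "subgroup G (sym_group n)")
  case True
  then show ?thesis
    using perm_action_group_action[OF True]
    unfolding transitive_perm_group_def transitive_action_def transitive_action_axioms_def
    by (simp del: atLeastAtMost_iff) blast
qed (simp add: transitive_perm_group_def)

lemma semiregular_perm_group_iff:
  "semiregular_perm_group n G \<longleftrightarrow>
    subgroup G (sym_group n) \<and> (\<forall>x \<in> {1..n}. \<forall>g \<in> G. g x = x \<longrightarrow> g = id)"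
proof (cases "subgroup G (sym_group n)")
  case True
  then have "id \<in> G"
    using subgroup.one_closed sym_group_one by metis
  then have "stabilizer (perm_group n G) (perm_action n) x = {id} \<longleftrightarrow>
      (\<forall>g \<in> G. g x = x \<longrightarrow> g = id)" if "x \<in> {1..n}" for x
    using that unfolding stabilizer_def by (simp del: atLeastAtMost_iff) fastforce
  then show ?thesis
    using True unfolding semiregular_perm_group_def sym_group_one by blast
qed (simp add: semiregular_perm_group_def)

end

theory Submission
  imports Defs
begin

text \<open>
  Bochert's argument. Choose \<open>\<Gamma>\<close> of maximal size such that only the identity of \<open>G\<close> is
  supported on \<open>\<Gamma>\<close>; then \<open>Sym(\<Gamma>)\<close> meets distinct cosets of \<open>G\<close>, so the index is at least
  \<open>|\<Gamma>|!\<close>. If \<open>2|\<Gamma>| < n\<close>, maximality yields a nontrivial \<open>h \<in> G\<close> supported on the complement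
  of \<open>\<Gamma>\<close>, and, for a point \<open>c\<close> moved by \<open>h\<close>, a nontrivial \<open>g \<in> G\<close> supported on \<open>\<Gamma> \<union> {c}\<close>.
  Their supports meet in \<open>c\<close> only, so their commutator is a 3-cycle. Lying in a common 3-cycle
  of \<open>G\<close> is a \<open>G\<close>-invariant equivalence relation, and the kernel of the action of \<open>G\<close> on its
  classes is a normal subgroup containing all 3-cycles of \<open>G\<close>. It is not semiregular (unless
  \<open>n = 3\<close>), hence transitive; so there is a single class, and \<open>G\<close> contains every 3-cycle.
\<close>

section \<open>Three-cycles and commutators\<close>

lemma cycle3_apply:
  assumes "distinct [x, y, z]"
  shows "cycle_of_list [x, y, z] x = y" "cycle_of_list [x, y, z] y = z"
    "cycle_of_list [x, y, z] z = x"
  using assms by (auto simp: transpose_def)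

lemma cycle3_fixes:
  assumes "w \<notin> {x, y, z}"
  shows "cycle_of_list [x, y, z] w = w"
  using assms by (intro id_outside_supp) auto

lemma cycle3_rotate:
  assumes "distinct [x, y, z]"
  shows "cycle_of_list [y, z, x] = cycle_of_list [x, y, z]"
  using assms by (auto simp: fun_eq_iff transpose_def)

lemma cycle3_inv:
  assumes "distinct [x, y, z]"
  shows "inv' (cycle_of_list [x, y, z]) = cycle_of_list [z, y, x]"
  by (rule inv_unique_comp) (use assms in \<open>auto simp: fun_eq_iff transpose_def\<close>)

text \<open>The point \<open>g c\<close> is moved by \<open>g\<close> and differs from
  \<open>c\<close>, so \<open>h\<close> fixes it; likewise \<open>g\<close> fixes
  \<open>h c\<close>. Hence \<open>g\<close> and \<open>h\<close> fail to commute only at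
  \<open>c\<close> and at its preimages under \<open>g\<close> and \<open>h\<close>.\<close>

lemma commutator_eq_cycle3:
  assumes "bij g" "bij h" and meet: "\<And>x. g x \<noteq> x \<and> h x \<noteq> x \<longleftrightarrow> x = c"
  shows "distinct [c, g c, h c]"
    and "g \<circ> h \<circ> inv' g \<circ> inv' h = cycle_of_list [c, g c, h c]"
proof -
  have g_inj: "g x = g y \<longleftrightarrow> x = y" and h_inj: "h x = h y \<longleftrightarrow> x = y" for x y
    using assms by (auto simp: bij_def inj_eq)
  have gc: "g c \<noteq> c" and hc: "h c \<noteq> c"
    using meet by auto
  have hgc: "h (g c) = g c" and ghc: "g (h c) = h c"
    using meet[of "g c"] meet[of "h c"] gc hc g_inj h_inj by auto
  show dist: "distinct [c, g c, h c]"
    using gc hc hgc h_inj by force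
  let ?k = "cycle_of_list [c, g c, h c]"
  \<comment> \<open>Comparing \<open>g \<circ> h\<close> with \<open>?k \<circ> h \<circ> g\<close>
    avoids inverses. In the first three cases \<open>h (g x)\<close> is \<open>g c\<close>,
    \<open>h c\<close> and \<open>c\<close> respectively; in the last one \<open>g\<close> and
    \<open>h\<close> commute at \<open>x\<close> and \<open>?k\<close> fixes the result.\<close>
  have "g (h x) = ?k (h (g x))" for x
  proof -
    consider "x = c" | "g x = c" | "h x = c" | "x \<noteq> c" "g x \<noteq> c" "h x \<noteq> c"
      by blast
    then show ?thesis
    proof cases
      case 1
      then show ?thesis using hgc ghc cycle3_apply[OF dist] by simp
    next
      case 2
      then have "h x = x" using meet[of x] gc by metis
      then show ?thesis using 2 cycle3_apply[OF dist] by simp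
    next
      case 3
      then have "g x = x" using meet[of x] hc by metis
      then show ?thesis using 3 cycle3_apply[OF dist] by simp
    next
      case 4
      then have fix_or: "g x = x \<or> h x = x" using meet[of x] by blast
      then have "g (h x) = h (g x)"
        using meet[of "h x"] meet[of "g x"] 4 g_inj h_inj by metis
      moreover have "h (g x) \<notin> {c, g c, h c}"
        using fix_or 4 hgc ghc g_inj h_inj calculation by (metis empty_iff insert_iff)
      ultimately show ?thesis using cycle3_fixes by metis
    qed
  qed
  then have eq: "g \<circ> h = ?k \<circ> (h \<circ> g)"
    by (simp add: fun_eq_iff del: cycle_of_list.simps)
  have "h \<circ> g \<circ> inv' g \<circ> inv' h = id"
    using assms by (simp add: fun_eq_iff bij_is_surj surj_f_inv_f)
  then show "g \<circ> h \<circ> inv' g \<circ> inv' h = ?k"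
    unfolding eq by (simp add: comp_assoc del: cycle_of_list.simps)
qed

section \<open>The relation of lying in a common 3-cycle\<close>

locale bij_group =
  fixes G :: "('a \<Rightarrow> 'a) set"
  assumes bij: "g \<in> G \<Longrightarrow> bij g"
    and comp_closed: "g \<in> G \<Longrightarrow> h \<in> G \<Longrightarrow> g \<circ> h \<in> G"
    and inv_closed: "g \<in> G \<Longrightarrow> inv' g \<in> G"
begin

text \<open>The disjunct \<open>x = y\<close> gives reflexivity even at points that no 3-cycle of
  \<open>G\<close> moves.\<close>

definition cycle_joined :: "'a \<Rightarrow> 'a \<Rightarrow> bool" where
  "cycle_joined x y \<longleftrightarrow> x = y \<or> (\<exists>z. distinct [x, y, z] \<and> cycle_of_list [x, y, z] \<in> G)"

lemma cycle3_conj_closed: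
  assumes "g \<in> G" "distinct [x, y, z]" "cycle_of_list [x, y, z] \<in> G"
  shows "cycle_of_list [g x, g y, g z] \<in> G"
  using conjugation_of_cycle[of "[x, y, z]" g] assms bij[of g]
    comp_closed[OF comp_closed[OF assms(1,3)] inv_closed[OF assms(1)]]
  by (simp del: cycle_of_list.simps)

lemma cycle3_rev_closed:
  assumes "distinct [x, y, z]" "cycle_of_list [x, y, z] \<in> G"
  shows "cycle_of_list [z, y, x] \<in> G"
  using cycle3_inv[OF assms(1)] inv_closed[OF assms(2)] by simp

lemma cycle_joinedI:
  assumes "distinct [x, y, z]" "cycle_of_list [x, y, z] \<in> G"
  shows "cycle_joined x y" "cycle_joined y z" "cycle_joined z x"
    "cycle_joined y x" "cycle_joined z y" "cycle_joined x z"
proof -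
  \<comment> \<open>Rotating a cycle gives three of the six pairs; the inverse cycle gives the other
    three.\<close>
  have base: "cycle_joined a b" "cycle_joined b c" "cycle_joined c a"
    if "distinct [a, b, c]" "cycle_of_list [a, b, c] \<in> G" for a b c
  proof -
    have d: "distinct [b, c, a]" "distinct [c, a, b]"
      using that by auto
    show "cycle_joined a b" "cycle_joined b c" "cycle_joined c a"
      using that d cycle3_rotate[OF that(1)] cycle3_rotate[OF d(1)]
      unfolding cycle_joined_def by metis+
  qed
  have "distinct [z, y, x]"
    using assms by auto
  then show "cycle_joined x y" "cycle_joined y z" "cycle_joined z x"
    "cycle_joined y x" "cycle_joined z y" "cycle_joined x z"
    using base[OF assms] base[OF _ cycle3_rev_closed[OF assms]] by auto
qed

lemma cycle_joined_refl: "cycle_joined x x"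
  by (simp add: cycle_joined_def)

lemma cycle_joined_sym:
  assumes "cycle_joined x y"
  shows "cycle_joined y x"
  using assms cycle_joinedI(4) unfolding cycle_joined_def by metis

lemma cycle_joined_image:
  assumes "g \<in> G" "cycle_joined x y"
  shows "cycle_joined (g x) (g y)"
proof (cases "x = y")
  case False
  then obtain z where z: "distinct [x, y, z]" "cycle_of_list [x, y, z] \<in> G"
    using assms(2) unfolding cycle_joined_def by blast
  have "distinct [g x, g y, g z]"
    using z(1) bij[OF assms(1)] by (auto simp: bij_def inj_eq)
  then show ?thesis
    using cycle3_conj_closed[OF assms(1) z] cycle_joinedI(1) by blast
qed (simp add: cycle_joined_refl)

text \<open>If \<open>(x y a)\<close> and \<open>g = (y z b)\<close> lie in \<open>G\<close> and \<open>g\<close> fixes \<open>x\<close>, then conjugation by \<open>g\<close>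
  turns \<open>(x y a)\<close> into a 3-cycle through \<open>x\<close> and \<open>z\<close>.\<close>

lemma cycle_joined_trans:
  assumes "cycle_joined x y" "cycle_joined y z"
  shows "cycle_joined x z"
proof (cases "x = y \<or> y = z \<or> x = z")
  case True
  then show ?thesis using assms cycle_joined_refl by auto
next
  case False
  then obtain b where b: "distinct [y, z, b]" "cycle_of_list [y, z, b] \<in> G"
    using assms(2) unfolding cycle_joined_def by blast
  show ?thesis
  proof (cases "x = b")
    case True
    then show ?thesis using cycle_joinedI(5)[OF b] by simp
  next
    case x: False
    have "cycle_of_list [y, z, b] x = x" "cycle_of_list [y, z, b] y = z"
      using False x cycle3_fixes[of x y z b] cycle3_apply[OF b(1)] by auto
    then show ?thesis
      using cycle_joined_image[OF b(2) assms(1)] by simp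
  qed
qed

text \<open>Joinedness provides (x y a) and (a z b) in \<open>G\<close> with no control over
  \<open>a\<close> and \<open>b\<close>. Conjugating the first cycle by the second or by its inverse
  turns it into (x y z) or the inverse of (x y z).\<close>

lemma all_cycle3_closed:
  assumes joined: "\<And>x y. x \<in> S \<Longrightarrow> y \<in> S \<Longrightarrow> cycle_joined x y"
    and supp: "\<And>g x. g \<in> G \<Longrightarrow> x \<notin> S \<Longrightarrow> g x = x"
    and S: "x \<in> S" "y \<in> S" "z \<in> S" and dist: "distinct [x, y, z]"
  shows "cycle_of_list [x, y, z] \<in> G"
proof -
  obtain a where a: "distinct [x, y, a]" "cycle_of_list [x, y, a] \<in> G"
    using joined[OF S(1,2)] dist unfolding cycle_joined_def by auto
  show ?thesis
  proof (cases "a = z")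
    case True
    then show ?thesis using a by simp
  next
    case False
    \<comment> \<open>The 3-cycle moves \<open>a\<close>, and elements of \<open>G\<close> move only
      points of \<open>S\<close>.\<close>
    have "a \<in> S"
      using supp[OF a(2)] cycle3_apply[OF a(1)] a(1) by force
    then obtain b where b: "distinct [a, z, b]" "cycle_of_list [a, z, b] \<in> G"
      using joined[OF _ S(3)] False unfolding cycle_joined_def by blast
    let ?h = "cycle_of_list [a, z, b]"
    let ?h' = "cycle_of_list [b, z, a]"
    note h = cycle3_apply[OF b(1)]
    have b': "distinct [b, z, a]" "?h' \<in> G"
      using b cycle3_rev_closed[OF b] by auto
    note h' = cycle3_apply[OF b'(1)]
    \<comment> \<open>If \<open>b\<close> is neither \<open>x\<close> nor \<open>y\<close>, then
      \<open>?h\<close> fixes both and sends \<open>a\<close> to \<open>z\<close>. Otherwise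
      \<open>?h'\<close> is used: it sends \<open>a\<close> to \<open>b\<close> and \<open>b\<close>
      to \<open>z\<close>, so the conjugated cycle again has entries \<open>x\<close>,
      \<open>y\<close>, \<open>z\<close>, but in the reverse cyclic order.\<close>
    consider "b \<notin> {x, y}" | "b = x" | "b = y"
      by blast
    then show ?thesis
    proof cases
      case 1
      then have "?h x = x" "?h y = y"
        using dist a(1) by (auto intro!: cycle3_fixes simp del: cycle_of_list.simps)
      then show ?thesis
        using cycle3_conj_closed[OF b(2) a] h by simp
    next
      case 2
      have "?h' y = y"
        using 2 dist a(1) by (auto intro!: cycle3_fixes simp del: cycle_of_list.simps)
      then have "cycle_of_list [z, y, x] \<in> G"
        using cycle3_conj_closed[OF b'(2) a] h' 2 by simp
      then show ?thesis
        using dist cycle3_rev_closed[of z y x] by auto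
    next
      case 3
      have "?h' x = x"
        using 3 dist a(1) by (auto intro!: cycle3_fixes simp del: cycle_of_list.simps)
      then have "cycle_of_list [x, z, y] \<in> G"
        using cycle3_conj_closed[OF b'(2) a] h' 3 by simp
      then have "cycle_of_list [y, z, x] \<in> G"
        using dist cycle3_rev_closed[of x z y] by auto
      then show ?thesis
        using dist cycle3_rotate[OF dist] by simp
    qed
  qed
qed

end

section \<open>Subgroups and normality in terms of composition and \<open>inv'\<close>\<close>

lemma subgroup_sym_group_iff:
  "subgroup H (sym_group n) \<longleftrightarrow> H \<subseteq> {p. p permutes {1..n}} \<and> id \<in> H \<and>
    (\<forall>g\<in>H. \<forall>h\<in>H. g \<circ> h \<in> H) \<and> (\<forall>g\<in>H. inv' g \<in> H)"
  (is "_ \<longleftrightarrow> ?R")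
proof
  assume H: "subgroup H (sym_group n)"
  have sub: "h \<in> carrier (sym_group n)" if "h \<in> H" for h
    using subgroup.subset[OF H] that by blast
  show ?R
    using subgroup.one_closed[OF H] subgroup.m_closed[OF H] subgroup.m_inv_closed[OF H] sub
    by (auto simp: sym_group_one sym_group_mult sym_group_carrier)
next
  assume ?R
  then show "subgroup H (sym_group n)"
    by (intro subgroup.intro)
      (auto simp: sym_group_one sym_group_mult sym_group_carrier subset_iff)
qed

lemma bij_group_if_subgroup:
  assumes "subgroup G (sym_group n)"
  shows "bij_group G"
  using assms by unfold_locales (auto simp: subgroup_sym_group_iff intro: permutes_bij)

lemma normal_perm_groupI:
  assumes G: "subgroup G (sym_group n)" and N: "subgroup N (sym_group n)" "N \<subseteq> G"
    and conj: "\<And>g h. g \<in> G \<Longrightarrow> h \<in> N \<Longrightarrow> g \<circ> h \<circ> inv' g \<in> N"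
  shows "N \<lhd> perm_group n G"
proof -
  interpret P: group "perm_group n G"
    using subgroup.subgroup_is_group[OF G sym_group_is_group] .
  have "inv\<^bsub>perm_group n G\<^esub> g = inv' g" if "g \<in> G" for g
    using that group.m_inv_consistent[OF sym_group_is_group G] subgroup.subset[OF G] by auto
  then show ?thesis
    unfolding P.normal_inv_iff
    using group.subgroup_incl[OF sym_group_is_group N(1) G N(2)] conj
    by (simp add: sym_group_mult)
qed

section \<open>Semiprimitive groups containing a 3-cycle\<close>

lemma semiprimitive_cycle3_imp_alt:
  assumes semi: "semiprimitive_perm_group n G"
    and dist: "distinct [a, b, c]" and abc: "cycle_of_list [a, b, c] \<in> G"
  shows "carrier (alt_group n) \<subseteq> G"
proof -
  have G: "subgroup G (sym_group n)"
    using semi by (simp add: semiprimitive_perm_group_def transitive_perm_group_def)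
  note Gc = G[unfolded subgroup_sym_group_iff]
  interpret bij_group G
    by (rule bij_group_if_subgroup[OF G])
  have supp: "g x = x" if "g \<in> G" "x \<notin> {1..n}" for g x
    using Gc that by (auto simp: permutes_def)
  have inv_apply: "g (inv' g x) = x" "inv' g (g x) = x" if "g \<in> G" for g x
    using bij[OF that] by (auto simp: bij_is_surj surj_f_inv_f bij_is_inj)
  \<comment> \<open>This is the kernel of the action of \<open>G\<close> on the classes of
    \<open>cycle_joined\<close>. Points outside \<open>{1..n}\<close> impose no condition, since
    \<open>G\<close> fixes them and the relation is reflexive.\<close>
  define N where "N = {g \<in> G. \<forall>x. cycle_joined (g x) x}"
  have N: "subgroup N (sym_group n)"
    unfolding subgroup_sym_group_iff
  proof (intro conjI ballI)
    show "N \<subseteq> {p. p permutes {1..n}}" "id \<in> N"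
      using Gc by (auto simp: N_def cycle_joined_refl)
    show "g \<circ> h \<in> N" if "g \<in> N" "h \<in> N" for g h
    proof -
      have "cycle_joined (g (h x)) x" for x
        using that cycle_joined_trans[of "g (h x)" "h x" x] by (simp add: N_def)
      then show ?thesis
        using that comp_closed by (simp add: N_def)
    qed
    show "inv' g \<in> N" if "g \<in> N" for g
    proof -
      have g: "g \<in> G" "\<And>x. cycle_joined (g x) x"
        using that by (auto simp: N_def)
      have "cycle_joined (inv' g x) x" for x
        using g(2)[of "inv' g x"] inv_apply(1)[OF g(1)] cycle_joined_sym by simp
      then show ?thesis
        using inv_closed[OF g(1)] by (simp add: N_def)
    qed
  qed
  have "N \<lhd> perm_group n G"
  proof (rule normal_perm_groupI[OF G N])
    show "N \<subseteq> G"
      by (auto simp: N_def)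
    show "g \<circ> h \<circ> inv' g \<in> N" if "g \<in> G" "h \<in> N" for g h
    proof -
      have h: "h \<in> G" "\<And>x. cycle_joined (h x) x"
        using that by (auto simp: N_def)
      have "cycle_joined (g (h (inv' g x))) x" for x
        using cycle_joined_image[OF that(1) h(2)[of "inv' g x"]] inv_apply(1)[OF that(1)] by simp
      then show ?thesis
        using comp_closed inv_closed that(1) h(1) by (simp add: N_def)
    qed
  qed
  then have or: "transitive_perm_group n N \<or> semiregular_perm_group n N"
    using semi by (simp add: semiprimitive_perm_group_def)
  have joined: "cycle_joined x y" if xy: "x \<in> {1..n}" "y \<in> {1..n}" for x y
  \<comment> \<open>If there is no further point, the given cycle joins all points directly.
    Otherwise it fixes some \<open>d\<close> and is a nontrivial element of \<open>N\<close>, which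
    rules out semiregularity.\<close>
  proof (cases "{1..n} \<subseteq> {a, b, c}")
    case True
    then show ?thesis
      using xy cycle_joinedI[OF dist abc] cycle_joined_refl by blast
  next
    case False
    then obtain d where d: "d \<in> {1..n}" "d \<notin> {a, b, c}"
      by blast
    have "cycle_joined (cycle_of_list [a, b, c] x) x" for x
    proof (cases "x \<in> {a, b, c}")
      case True
      then show ?thesis
        using cycle3_apply[OF dist] cycle_joinedI[OF dist abc] by auto
    qed (simp add: cycle3_fixes cycle_joined_refl del: cycle_of_list.simps)
    then have "cycle_of_list [a, b, c] \<in> N"
      using abc by (simp add: N_def del: cycle_of_list.simps)
    moreover have "cycle_of_list [a, b, c] d = d"
      using d(2) by (rule cycle3_fixes)
    moreover have "cycle_of_list [a, b, c] \<noteq> id"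
      using cycle3_apply(1)[OF dist] dist by (metis distinct_length_2_or_more id_apply)
    ultimately have "\<not> semiregular_perm_group n N"
      using d(1) unfolding semiregular_perm_group_iff by blast
    then obtain g where "g \<in> N" "g y = x"
      using or xy unfolding transitive_perm_group_iff by blast
    then show ?thesis
      by (auto simp: N_def)
  qed
  have three: "three_cycles n \<subseteq> G"
  proof
    fix p assume "p \<in> three_cycles n"
    then obtain cs where cs: "p = cycle_of_list cs" "distinct cs" "length cs = 3" "set cs \<subseteq> {1..n}"
      by blast
    then obtain x y z where xyz: "cs = [x, y, z]"
      by (auto simp: numeral_3_eq_3 length_Suc_conv)
    show "p \<in> G"
      unfolding cs(1) xyz
      by (rule all_cycle3_closed[where S = "{1..n}"]) (use joined supp cs xyz in auto)
  qed
  show ?thesis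
  proof
    fix p assume "p \<in> carrier (alt_group n)"
    then have "p \<in> generate (alt_group n) (three_cycles n)"
      by (simp add: alt_group_carrier_as_three_cycles)
    then show "p \<in> G"
    proof induction
      case one
      then show ?case using Gc by (metis alt_group_one)
    next
      case (incl h)
      then show ?case using three by blast
    next
      case (inv h)
      then have "inv\<^bsub>alt_group n\<^esub> h = inv' h"
        using three_cycles_incl by (intro alt_group_inv_equality) blast
      moreover have "h \<in> G"
        using inv three by blast
      ultimately show ?case
        using inv_closed by simp
    next
      case (eng h1 h2)
      then show ?case using comp_closed unfolding alt_group_mult by blast
    qed
  qed
qed

section \<open>The bound on the index\<close>

text \<open>If permutations \<open>p\<close> and \<open>q\<close> of \<open>S\<close> lie in the
  same right coset, then \<open>q \<circ> inv' p\<close> lies in \<open>G\<close> and permutes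
  \<open>S\<close>, so it is the identity.\<close>

lemma fact_card_le_card_rcosets:
  assumes G: "subgroup G (sym_group n)" and S: "S \<subseteq> {1..n}"
    and triv: "\<And>g. g \<in> G \<Longrightarrow> g permutes S \<Longrightarrow> g = id"
  shows "fact (card S) \<le> card (rcosets\<^bsub>sym_group n\<^esub> G)"
proof -
  interpret Sn: group "sym_group n"
    by (rule sym_group_is_group)
  have fin: "finite S"
    using S finite_subset by blast
  have carr: "p \<in> carrier (sym_group n)" if "p permutes S" for p
    using permutes_subset[OF that S] by (simp add: sym_group_carrier)
  have "inj_on (\<lambda>p. G #>\<^bsub>sym_group n\<^esub> p) {p. p permutes S}"
  proof (rule inj_onI, clarify)
    fix p q assume p: "p permutes S" and q: "q permutes S"
      and "G #>\<^bsub>sym_group n\<^esub> p = G #>\<^bsub>sym_group n\<^esub> q"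
    then have "q \<in> G #>\<^bsub>sym_group n\<^esub> p"
      using Sn.repr_independenceD[OF G carr[OF q]] by simp
    then obtain g where g: "g \<in> G" "q = g \<circ> p"
      by (auto simp: r_coset_def sym_group_mult)
    then have "q \<circ> inv' p = g"
      using permutes_inv_o(1)[OF p] by (simp add: comp_assoc)
    then have "g permutes S"
      using permutes_compose[OF permutes_inv[OF p] q] by simp
    then show "p = q"
      using triv[OF g(1)] g(2) by simp
  qed
  moreover have "(\<lambda>p. G #>\<^bsub>sym_group n\<^esub> p) ` {p. p permutes S} \<subseteq> rcosets\<^bsub>sym_group n\<^esub> G"
    using carr Sn.rcosetsI[OF subgroup.subset[OF G]] by blast
  moreover have "finite (rcosets\<^bsub>sym_group n\<^esub> G)"
  proof -
    have "finite (carrier (sym_group n))"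
      by (simp add: sym_group_def finite_permutations)
    then show ?thesis
      by (simp add: RCOSETS_def)
  qed
  ultimately have "card {p. p permutes S} \<le> card (rcosets\<^bsub>sym_group n\<^esub> G)"
    by (rule card_inj_on_le)
  then show ?thesis
    using card_permutations[OF refl fin] by simp
qed

theorem lemma10p2:
  fixes n :: nat and G :: "(nat \<Rightarrow> nat) set"
  assumes "subgroup G (sym_group n)"
    and "semiprimitive_perm_group n G"
    and "\<not> carrier (alt_group n) \<subseteq> G"
  shows "card (rcosets\<^bsub>sym_group n\<^esub> G) \<ge> fact ((n + 1) div 2)"
proof -
  interpret bij_group G
    by (rule bij_group_if_subgroup[OF assms(1)])
  define free where "free S \<longleftrightarrow> S \<subseteq> {1..n} \<and> (\<forall>g\<in>G. g permutes S \<longrightarrow> g = id)" for S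
  have "free {}"
    by (simp add: free_def)
  moreover have "card S \<le> n" if "free S" for S
    using that card_mono[of "{1..n}" S] by (simp add: free_def)
  ultimately have "\<exists>S. free S \<and> (\<forall>T. free T \<longrightarrow> card T \<le> card S)"
    by (intro ex_has_greatest_nat[of free "{}" card "Suc n"]) (auto simp: less_Suc_eq_le)
  then obtain S where S: "free S" and max: "\<And>T. free T \<Longrightarrow> card T \<le> card S"
    by blast
  have sub: "S \<subseteq> {1..n}" and fin: "finite S"
    using S finite_subset[of S "{1..n}"] by (auto simp: free_def)
  have "(n + 1) div 2 \<le> card S"
  proof (rule ccontr)
    assume "\<not> (n + 1) div 2 \<le> card S"
    \<comment> \<open>The assumption amounts to \<open>2 * card S + 1 \<le> n\<close>, so the
      complement is strictly larger than \<open>S\<close> and maximality applies to it.\<close>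
    then have "card S < card ({1..n} - S)"
      using card_Diff_subset[OF fin sub] by simp
    then have "\<not> free ({1..n} - S)"
      using max by (simp add: not_le[symmetric]) blast
    then obtain h where h: "h \<in> G" "h permutes {1..n} - S" "h \<noteq> id"
      by (auto simp: free_def)
    then obtain c where c: "h c \<noteq> c"
      by (auto simp: fun_eq_iff)
    then have c_mem: "c \<in> {1..n}" "c \<notin> S"
      using h(2) by (auto simp: permutes_def)
    then have "\<not> free (insert c S)"
      using max[of "insert c S"] fin by auto
    then obtain g where g: "g \<in> G" "g permutes insert c S" "g \<noteq> id"
      using sub c_mem(1) by (auto simp: free_def)
    \<comment> \<open>Otherwise \<open>g\<close> would be a nontrivial element of \<open>G\<close>
      permuting \<open>S\<close>, which is free.\<close>
    have "g c \<noteq> c"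
    proof
      assume "g c = c"
      then have "g permutes S"
        using permutes_superset[OF g(2), of S] by blast
      then show False
        using S g by (simp add: free_def)
    qed
    \<comment> \<open>Points moved by \<open>g\<close> lie in \<open>insert c S\<close>, those moved
      by \<open>h\<close> lie outside \<open>S\<close>.\<close>
    moreover have "x = c" if "g x \<noteq> x" "h x \<noteq> x" for x
      using that g(2) h(2) unfolding permutes_def by blast
    ultimately have meet: "g x \<noteq> x \<and> h x \<noteq> x \<longleftrightarrow> x = c" for x
      using c by blast
    have "g \<circ> h \<circ> inv' g \<circ> inv' h \<in> G"
      using g(1) h(1) comp_closed inv_closed by blast
    then have "carrier (alt_group n) \<subseteq> G"
      using commutator_eq_cycle3[OF bij[OF g(1)] bij[OF h(1)] meet]
        semiprimitive_cycle3_imp_alt[OF assms(2)] by simp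
    then show False
      using assms(3) by blast
  qed
  then have "fact ((n + 1) div 2) \<le> (fact (card S) :: nat)"
    by (rule fact_mono)
  also have "\<dots> \<le> card (rcosets\<^bsub>sym_group n\<^esub> G)"
    using fact_card_le_card_rcosets[OF assms(1) sub] S by (simp add: free_def)
  finally show ?thesis .
qed

end
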